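(* Let $P_\infty\square P_\infty\square P_\infty$ be the infinite 3-dimensional grid. Then $10\le \operatorname{gp}(P_\infty\square P_\infty\square P_\infty)\le 16$.
   Context: $P_\infty$ is the two-way infinite path with vertices $v_i$, $i\in\mathbb{Z}$, where $v_i$ and $v_j$ are adjacent iff $|i-j|=1$. The Cartesian product $G\square H$ has vertex set $V(G)\times V(H)$, with $(g,h)$ and $(g',h')$ adjacent if either $g=g'$ and $hh'\in E(H)$, or $h=h'$ and $gg'\in E(G)$. A geodesic of a graph is a shortest path. A set $S$ of vertices of a graph $G$ is a general position set if no three distinct vertices of $S$ lie on a common geodesic of $G$. The general position number $\operatorname{gp}(G)$ is the maximum cardinality of a general position set of $G$. *)

theory Defs
  imports
    "Graph_Theory.Pair_Digraph"
    "Graph_Theory.Vertex_Walk"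
    "HOL-Library.Extended_Nat"
begin

(* Simple graphs are encoded as loop-free symmetric pair digraphs: an edge between u and v is the
   pair of arcs (u,v) and (v,u). *)

definition P_inf :: "int pair_pre_digraph" where
  "P_inf = \<lparr> pverts = UNIV, parcs = {(i, j). \<bar>i - j\<bar> = 1} \<rparr>"

definition cartesian_product ::
  "'a pair_pre_digraph \<Rightarrow> 'b pair_pre_digraph \<Rightarrow> ('a \<times> 'b) pair_pre_digraph" (infixl "\<box>" 75) where
  "G \<box> H = \<lparr> pverts = pverts G \<times> pverts H,
     parcs = {((g, h), (g', h')).
        g \<in> pverts G \<and> g = g' \<and> (h, h') \<in> parcs H \<or>
        h \<in> pverts H \<and> h = h' \<and> (g, g') \<in> parcs G} \<rparr>"

lemma P_inf_graph: "pair_wf_digraph P_inf" "sym (parcs P_inf)" "irrefl (parcs P_inf)"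
  by (auto simp: P_inf_def pair_wf_digraph_def sym_def irrefl_def)

lemma cartesian_product_graph:
  assumes "pair_wf_digraph G" "sym (parcs G)" "irrefl (parcs G)"
    and "pair_wf_digraph H" "sym (parcs H)" "irrefl (parcs H)"
  shows "pair_wf_digraph (G \<box> H)" "sym (parcs (G \<box> H))" "irrefl (parcs (G \<box> H))"
  using assms by (fastforce simp: cartesian_product_def pair_wf_digraph_def sym_def irrefl_def)+

(* Paths are given by their nonempty lists of vertices; a geodesic is a shortest path between its
   two end vertices. *)
definition geodesic :: "'a pair_pre_digraph \<Rightarrow> 'a list \<Rightarrow> bool" where
  "geodesic G p \<longleftrightarrow> vpath p (with_proj G) \<and>
     (\<forall>q. vpath q (with_proj G) \<and> hd q = hd p \<and> last q = last p \<longrightarrow>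
        vwalk_length p \<le> vwalk_length q)"

definition general_position_set :: "'a pair_pre_digraph \<Rightarrow> 'a set \<Rightarrow> bool" where
  "general_position_set G S \<longleftrightarrow> S \<subseteq> pverts G \<and>
     (\<forall>x\<in>S. \<forall>y\<in>S. \<forall>z\<in>S. x \<noteq> y \<and> y \<noteq> z \<and> x \<noteq> z \<longrightarrow>
        \<not> (\<exists>p. geodesic G p \<and> {x, y, z} \<subseteq> set p))"

(* The value is \<infinity> if the cardinalities of general position sets are unbounded or if some general
   position set is infinite. A finite value is attained, see gp_eq_enat_iff. *)
definition gp :: "'a pair_pre_digraph \<Rightarrow> enat" where
  "gp G = (SUP S \<in> {S. general_position_set G S}. if finite S then enat (card S) else \<infinity>)"

lemma gp_eq_enat_iff:
  "gp G = enat n \<longleftrightarrow>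
     (\<exists>S. general_position_set G S \<and> finite S \<and> card S = n) \<and>
     (\<forall>S. general_position_set G S \<longrightarrow> finite S \<and> card S \<le> n)"
  (is "_ \<longleftrightarrow> ?A \<and> ?B")
proof
  let ?c = "\<lambda>S :: 'a set. if finite S then enat (card S) else \<infinity>"
  let ?C = "?c ` {S. general_position_set G S}"
  assume gp: "gp G = enat n"
  have le: "?c S \<le> enat n" if "general_position_set G S" for S
    using that unfolding gp[symmetric] gp_def by (intro SUP_upper) simp
  have B: ?B
    using le by (metis enat_ord_simps(1) enat_ord_simps(5) infinity_ne_i0 enat.distinct(1))
  have "general_position_set G {}"
    by (simp add: general_position_set_def)
  then have "?C \<noteq> {}" by blast
  moreover have "finite ?C"
    by (rule finite_subset[of _ "enat ` {..n}"]) (use B in auto)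
  ultimately have "Sup ?C \<in> ?C"
    by (metis Max_in Max_Sup Sup_enat_def)
  then have "enat n \<in> ?C"
    using gp by (simp add: gp_def)
  then have ?A by (auto split: if_splits)
  with B show "?A \<and> ?B" by blast
next
  assume AB: "?A \<and> ?B"
  then obtain S where S: "general_position_set G S" "finite S" "card S = n" by blast
  show "gp G = enat n"
    unfolding gp_def
  proof (rule antisym)
    show "(SUP S \<in> {S. general_position_set G S}. if finite S then enat (card S) else \<infinity>) \<le> enat n"
      using AB by (intro SUP_least) auto
    show "enat n \<le> (SUP S \<in> {S. general_position_set G S}. if finite S then enat (card S) else \<infinity>)"
      by (rule SUP_upper2[of S]) (use S in auto)
  qed
qed

end

theory Submission
  imports Defs
begin

text \<open>
  Distance in the grid is Manhattan distance, and three vertices lie on a common geodesic exactly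
  when one of them lies, coordinate by coordinate, between the two others
  (lemma \<open>general_position_grid_iff\<close>). So a set is in general position iff it contains no three
  distinct points that form a chain, that is, a sequence each of whose coordinates is weakly
  monotone. After possibly reversing the chain, the first coordinate increases, and the directions
  of the other two coordinates leave four types of chain.

  Upper bound. Any two distinct points form a chain of length two for some type, with the point of
  smaller first coordinate coming first (either one if these are equal). Label a point of \<open>S\<close> by the
  set of types for which it has a predecessor in \<open>S\<close>. If \<open>u\<close> precedes \<open>v\<close> for some type, then this
  type is in the label of \<open>v\<close>, and if it were in the label of \<open>u\<close> as well, then \<open>S\<close> would contain a
  chain of three points. So distinct points have distinct labels, and there are only \<open>2 ^ 4\<close> labels.
  This is the argument of Erdos and Szekeres for monotone subsequences, with all types treated at once.

  Lower bound. The labels also show how to reach 16: index the points by four binary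
  digits, one digit for each type of chain, and let the most significant digit in which two points
  differ decide the type for which they are comparable (\<open>digit_point\<close>). A chain of three points
  would need the same leading digit to change in the same direction twice, which a binary digit
  cannot do. Hence the general position number of the grid is exactly 16
  (lemma \<open>gp_grid\<close>), and both bounds follow.
\<close>

section \<open>Geodesics of the grid and the Manhattan metric\<close>

abbreviation grid :: "((int \<times> int) \<times> int) pair_pre_digraph" where
  "grid \<equiv> P_inf \<box> P_inf \<box> P_inf"

fun manhattan :: "(int \<times> int) \<times> int \<Rightarrow> (int \<times> int) \<times> int \<Rightarrow> int" where
  "manhattan ((a, b), c) ((a', b'), c') = \<bar>a - a'\<bar> + \<bar>b - b'\<bar> + \<bar>c - c'\<bar>"

lemma manhattan_nonneg: "0 \<le> manhattan u v"
  by (cases "(u, v)" rule: manhattan.cases) simp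

lemma manhattan_eq_0_iff: "manhattan u v = 0 \<longleftrightarrow> u = v"
  by (cases "(u, v)" rule: manhattan.cases) auto

lemma manhattan_commute: "manhattan u v = manhattan v u"
  by (cases "(u, v)" rule: manhattan.cases) simp

lemma manhattan_triangle: "manhattan u w \<le> manhattan u v + manhattan v w"
  by (cases "(u, v)" rule: manhattan.cases; cases w; cases "fst w") simp

lemma pverts_grid: "pverts grid = UNIV"
  by (simp add: cartesian_product_def P_inf_def)

lemma parcs_grid: "(u, v) \<in> parcs grid \<longleftrightarrow> manhattan u v = 1"
  by (cases "(u, v)" rule: manhattan.cases) (auto simp: cartesian_product_def P_inf_def)

text \<open>
  A neighbour of \<open>u\<close> that is closer to \<open>v\<close>: one step towards \<open>v\<close> in any coordinate that differs.
\<close>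
lemma manhattan_step:
  assumes "u \<noteq> v"
  obtains w where "manhattan u w = 1" "manhattan w v = manhattan u v - 1"
proof (cases "(u, v)" rule: manhattan.cases)
  case (1 a b c a' b' c')
  consider "a \<noteq> a'" | "b \<noteq> b'" | "c \<noteq> c'"
    using assms 1 by auto
  then show thesis
  proof cases
    case c: 1
    show thesis
      by (rule that[of "((a + sgn (a' - a), b), c)"]) (use 1 c in \<open>auto simp: sgn_if\<close>)
  next
    case c: 2
    show thesis
      by (rule that[of "((a, b + sgn (b' - b)), c)"]) (use 1 c in \<open>auto simp: sgn_if\<close>)
  next
    case c: 3
    show thesis
      by (rule that[of "((a, b), c + sgn (c' - c))"]) (use 1 c in \<open>auto simp: sgn_if\<close>)
  qed
qed

lemma grid_walk_of_manhattan_length: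
  "\<exists>p. vwalk p grid \<and> hd p = u \<and> last p = v \<and> int (length p) = manhattan u v + 1"
proof (induction "nat (manhattan u v)" arbitrary: u)
  case 0
  then have "u = v"
    using manhattan_nonneg[of u v] manhattan_eq_0_iff[of u v] by simp
  then have "vwalk [u] grid \<and> hd [u] = u \<and> last [u] = v \<and> int (length [u]) = manhattan u v + 1"
    by (simp add: vwalk_def pverts_grid manhattan_eq_0_iff)
  then show ?case by blast
next
  case (Suc n)
  then have "u \<noteq> v"
    using manhattan_eq_0_iff[of u v] by auto
  then obtain w where w: "manhattan u w = 1" "manhattan w v = manhattan u v - 1"
    by (rule manhattan_step)
  with Suc.hyps(2) have "n = nat (manhattan w v)" by simp
  from Suc.hyps(1)[OF this] obtain p
    where p: "vwalk p grid" "hd p = w" "last p = v" "int (length p) = manhattan w v + 1"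
    by blast
  have "vwalk (u # p) grid"
    by (rule vwalk_consI) (use p w in \<open>simp_all add: pverts_grid parcs_grid\<close>)
  moreover have "p \<noteq> []" using p(1) by auto
  ultimately have "vwalk (u # p) grid \<and> hd (u # p) = u \<and> last (u # p) = v \<and>
      int (length (u # p)) = manhattan u v + 1"
    using p w by simp
  then show ?case by blast
qed

lemma vwalk_nth_arc:
  assumes "vwalk p grid" "Suc i < length p"
  shows "manhattan (p ! i) (p ! Suc i) = 1"
proof -
  have "vwalk p grid \<Longrightarrow> \<forall>i. Suc i < length p \<longrightarrow> (p ! i, p ! Suc i) \<in> parcs grid"
  proof (induction p rule: vwalk_induct)
    case (Cons u v es)
    then show ?case by (auto simp: nth_Cons split: nat.split)
  qed simp
  then show ?thesis using assms parcs_grid by blast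
qed

lemma manhattan_nth_le:
  assumes "vwalk p grid" "i \<le> j" "j < length p"
  shows "manhattan (p ! i) (p ! j) \<le> int j - int i"
  using assms(2,3)
proof (induction j rule: dec_induct)
  case base
  show ?case by (simp add: manhattan_eq_0_iff[THEN iffD2])
next
  case (step j)
  then show ?case
    using manhattan_triangle[of "p ! i" "p ! Suc j" "p ! j"] vwalk_nth_arc[OF assms(1), of j]
    by simp
qed

text \<open>
  A walk whose length is the distance of its ends has no slack: if some segment were longer than the
  distance of the ends of that segment, then the triangle inequality would make the whole walk too
  long.
\<close>
lemma manhattan_nth_tight:
  assumes p: "vwalk p grid" "int (length p) \<le> manhattan (hd p) (last p) + 1"
    and ij: "i \<le> j" "j < length p"
  shows "manhattan (p ! i) (p ! j) = int j - int i"
proof -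
  let ?n = "length p - 1"
  have "p \<noteq> []" using p(1) by auto
  then have "int ?n \<le> manhattan (p ! 0) (p ! ?n)"
    using p(2) hd_conv_nth[of p] last_conv_nth[of p] by (simp add: of_nat_diff Suc_le_eq)
  moreover have "manhattan (p ! 0) (p ! i) \<le> int i"
    using manhattan_nth_le[OF p(1), of 0 i] ij by simp
  moreover have "manhattan (p ! j) (p ! ?n) \<le> int ?n - int j"
    by (rule manhattan_nth_le[OF p(1)]) (use ij in linarith)+
  moreover have "manhattan (p ! i) (p ! j) \<le> int j - int i"
    by (rule manhattan_nth_le[OF p(1) ij])
  ultimately show ?thesis
    using manhattan_triangle[of "p ! 0" "p ! ?n" "p ! i"]
      manhattan_triangle[of "p ! i" "p ! ?n" "p ! j"] by linarith
qed

text \<open>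
  Geodesics are paths by definition, but a walk without slack cannot visit a vertex twice. So
  Manhattan distance, which walks attain, is also attained by paths.
\<close>
lemma geodesic_grid_iff:
  "geodesic grid p \<longleftrightarrow> vwalk p grid \<and> int (length p) = manhattan (hd p) (last p) + 1"
proof -
  have lower: "manhattan (hd q) (last q) + 1 \<le> int (length q)" if "vwalk q grid" for q
  proof -
    have "q \<noteq> []" using that by auto
    then show ?thesis
      using manhattan_nth_le[OF that, of 0 "length q - 1"] hd_conv_nth[of q] last_conv_nth[of q]
      by (simp add: of_nat_diff Suc_le_eq)
  qed
  have path: "vpath q grid" if q: "vwalk q grid" "int (length q) = manhattan (hd q) (last q) + 1" for q
  proof -
    have "q ! i \<noteq> q ! j" if "i < j" "j < length q" for i j
      using manhattan_nth_tight[of q i j] q that manhattan_eq_0_iff[of "q ! i" "q ! j"] by auto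
    then have "distinct q"
      unfolding distinct_conv_nth by (metis linorder_neqE_nat)
    then show ?thesis using q by blast
  qed
  show ?thesis
  proof
    assume geo: "geodesic grid p"
    then have walk: "vwalk p grid" by (auto simp: geodesic_def vpath_def)
    obtain q where q: "vwalk q grid" "hd q = hd p" "last q = last p"
      "int (length q) = manhattan (hd p) (last p) + 1"
      using grid_walk_of_manhattan_length by blast
    with path[of q] geo have "length p - 1 \<le> length q - 1"
      by (auto simp: geodesic_def)
    moreover have "p \<noteq> []" "q \<noteq> []" using walk q(1) by auto
    ultimately show "vwalk p grid \<and> int (length p) = manhattan (hd p) (last p) + 1"
      using walk q(4) lower[OF walk] by (cases p; cases q) auto
  next
    assume p: "vwalk p grid \<and> int (length p) = manhattan (hd p) (last p) + 1"
    moreover have "length p - 1 \<le> length q - 1"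
      if "vpath q grid" "hd q = hd p" "last q = last p" for q
      using lower[of q] that p by (auto simp: vpath_def)
    ultimately show "geodesic grid p"
      using path[of p] by (auto simp: geodesic_def)
  qed
qed

text \<open>
  Two geodesics, from \<open>x\<close> to \<open>y\<close> and from \<open>y\<close> to \<open>z\<close>, join to a walk of length
  \<open>manhattan x y + manhattan y z\<close>, which equality in the triangle inequality makes a geodesic.
\<close>
lemma geodesic_through_between:
  assumes "manhattan x y + manhattan y z = manhattan x z"
  shows "\<exists>p. geodesic grid p \<and> {x, y, z} \<subseteq> set p"
proof -
  obtain p where p: "vwalk p grid" "hd p = x" "last p = y" "int (length p) = manhattan x y + 1"
    using grid_walk_of_manhattan_length by blast
  obtain q where q: "vwalk q grid" "hd q = y" "last q = z" "int (length q) = manhattan y z + 1"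
    using grid_walk_of_manhattan_length by blast
  have ne: "p \<noteq> []" "q \<noteq> []" using p(1) q(1) by auto
  then have join: "joinable p q" using p(3) q(2) by simp
  have "vwalk (p \<oplus> q) grid"
    using p(1) q(1) join by (rule vwalk_joinI_vwalk)
  moreover have "hd (p \<oplus> q) = x" "last (p \<oplus> q) = z"
    using vwalk_join_hd[OF join] vwalk_join_last[OF join] p(2) q(3) by auto
  moreover have "int (length (p \<oplus> q)) = manhattan x z + 1"
    using p(4) q(4) assms ne by (cases q) (auto simp: vwalk_join_def)
  moreover have "y \<in> set (p \<oplus> q)"
    using p(3) ne by (auto simp: vwalk_join_def)
  ultimately show ?thesis
    unfolding geodesic_grid_iff
    by (intro exI[of _ "p \<oplus> q"]) (metis empty_subsetI hd_in_set insert_subset last_in_set ne(1) vwalk_join_non_Nil)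
qed

text \<open>
  General position becomes a purely metric condition. For the direction from right to left, positions
  along a geodesic embed it isometrically into the line, where one of any three points lies between
  the two others.
\<close>
lemma general_position_grid_iff:
  "general_position_set grid S \<longleftrightarrow>
     (\<forall>x\<in>S. \<forall>y\<in>S. \<forall>z\<in>S. x \<noteq> y \<and> y \<noteq> z \<and> x \<noteq> z \<longrightarrow>
        manhattan x y + manhattan y z \<noteq> manhattan x z)"
  (is "_ \<longleftrightarrow> ?R")
proof
  assume S: "general_position_set grid S"
  show ?R
  proof (intro ballI impI notI)
    fix x y z
    assume "x \<in> S" "y \<in> S" "z \<in> S" "x \<noteq> y \<and> y \<noteq> z \<and> x \<noteq> z"
    then have "\<nexists>p. geodesic grid p \<and> {x, y, z} \<subseteq> set p"
      using S unfolding general_position_set_def by (elim conjE) metis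
    moreover assume "manhattan x y + manhattan y z = manhattan x z"
    ultimately show False
      using geodesic_through_between by metis
  qed
next
  assume R: ?R
  have False if xyz: "x \<in> S" "y \<in> S" "z \<in> S" "x \<noteq> y" "y \<noteq> z" "x \<noteq> z"
    and p: "geodesic grid p" "{x, y, z} \<subseteq> set p" for x y z p
  proof -
    have walk: "vwalk p grid" "int (length p) \<le> manhattan (hd p) (last p) + 1"
      using p(1) unfolding geodesic_grid_iff by simp_all
    have tight: "manhattan (p ! i) (p ! j) = \<bar>int i - int j\<bar>" if "i < length p" "j < length p" for i j
    proof (cases "i \<le> j")
      case True
      then show ?thesis
        using manhattan_nth_tight[OF walk True that(2)] by simp
    next
      case False
      then have "j \<le> i" by simp
      then show ?thesis
        using manhattan_nth_tight[OF walk \<open>j \<le> i\<close> that(1)] manhattan_commute[of "p ! i" "p ! j"]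
        by simp
    qed
    obtain i j k where "i < length p" "j < length p" "k < length p" "x = p ! i" "y = p ! j" "z = p ! k"
      using p(2) by (metis in_set_conv_nth insert_subset)
    then have "manhattan x y = \<bar>int i - int j\<bar>" "manhattan y z = \<bar>int j - int k\<bar>"
      "manhattan x z = \<bar>int i - int k\<bar>"
      using tight by auto
    moreover have "manhattan x y + manhattan y z \<noteq> manhattan x z"
      "manhattan y z + manhattan x z \<noteq> manhattan x y"
      "manhattan x y + manhattan x z \<noteq> manhattan y z"
      using R xyz manhattan_commute by metis+
    ultimately show False by linarith
  qed
  then show "general_position_set grid S"
    unfolding general_position_set_def pverts_grid by blast
qed

section \<open>The upper bound\<close>

text \<open>
  The four types of chain are indexed by two truth values, which say whether the second and the third
  coordinate increase. Each of these relations is the strict part of a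
  product order on the grid, with the order of a decreasing coordinate reversed.
\<close>
fun precedes :: "bool \<times> bool \<Rightarrow> (int \<times> int) \<times> int \<Rightarrow> (int \<times> int) \<times> int \<Rightarrow> bool" where
  "precedes (s, t) ((a, b), c) ((a', b'), c') \<longleftrightarrow> ((a, b), c) \<noteq> ((a', b'), c') \<and>
     a \<le> a' \<and> (if s then b \<le> b' else b' \<le> b) \<and> (if t then c \<le> c' else c' \<le> c)"

lemma precedes_total:
  assumes "u \<noteq> v"
  obtains \<sigma> where "precedes \<sigma> u v \<or> precedes \<sigma> v u"
proof (cases "(u, v)" rule: manhattan.cases)
  case (1 a b c a' b' c')
  show thesis
  proof (cases "a \<le> a'")
    case True
    then show thesis
      using assms 1 by (intro that[of "(b \<le> b', c \<le> c')"]) auto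
  next
    case False
    then show thesis
      using assms 1 by (intro that[of "(b' \<le> b, c' \<le> c)"]) auto
  qed
qed

text \<open>
  Along a chain each coordinate is monotone, so the absolute differences add up. That \<open>u \<noteq> w\<close> is
  antisymmetry of the product order.
\<close>
lemma precedes_chain:
  assumes "precedes \<sigma> u v" "precedes \<sigma> v w"
  shows "u \<noteq> v" "v \<noteq> w" "u \<noteq> w" "manhattan u v + manhattan v w = manhattan u w"
proof -
  obtain s t where \<sigma>: "\<sigma> = (s, t)" by fastforce
  obtain a b c a' b' c' where uv: "u = ((a, b), c)" "v = ((a', b'), c')"
    by (cases "(u, v)" rule: manhattan.cases) auto
  obtain a'' b'' c'' where w: "w = ((a'', b''), c'')"
    by (metis surj_pair)
  show "u \<noteq> v" "v \<noteq> w"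
    using assms unfolding \<sigma> uv w by auto
  show "u \<noteq> w"
    using assms unfolding \<sigma> uv w by (cases s; cases t) auto
  show "manhattan u v + manhattan v w = manhattan u w"
    using assms unfolding \<sigma> uv w by (cases s; cases t) simp_all
qed

text \<open>
  \<open>L v\<close> is the label of \<open>v\<close>: the types for which \<open>v\<close> ends a chain of length two in \<open>S\<close>. Finiteness
  of \<open>S\<close> comes from the same injection as the bound.
\<close>
lemma general_position_grid_card_le:
  assumes "general_position_set grid S"
  shows "finite S \<and> card S \<le> 16"
proof -
  define L where "L v = {\<sigma>. \<exists>u\<in>S. precedes \<sigma> u v}" for v
  have no_chain: False if "u \<in> S" "v \<in> S" "w \<in> S" "precedes \<sigma> u v" "precedes \<sigma> v w" for \<sigma> u v w
    using assms that precedes_chain[OF that(4,5)] unfolding general_position_grid_iff by blast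
  have not_equal: False if "u \<in> S" "v \<in> S" "precedes \<sigma> u v" "L u = L v" for \<sigma> u v
  proof -
    have "\<sigma> \<in> L u" using that by (auto simp: L_def)
    then obtain w where "w \<in> S" "precedes \<sigma> w u" by (auto simp: L_def)
    then show False using no_chain that by blast
  qed
  have "inj_on L S"
  proof (rule inj_onI, rule ccontr)
    fix u v assume uv: "u \<in> S" "v \<in> S" "L u = L v" "u \<noteq> v"
    from uv(4) obtain \<sigma> where "precedes \<sigma> u v \<or> precedes \<sigma> v u"
      by (rule precedes_total)
    then show False using not_equal uv by metis
  qed
  moreover have "card (UNIV :: (bool \<times> bool) set set) = 16"
    by (simp add: card_Pow flip: Pow_UNIV) (simp add: card_cartesian_product flip: UNIV_Times_UNIV)
  ultimately show ?thesis
    by (metis card_inj_on_le finite finite_imageD subset_UNIV)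
qed

section \<open>Sixteen points in general position\<close>

text \<open>
  The weights \<open>8, 4, 2, 1\<close> let the leading digit in which two points differ outweigh all later
  ones, so that digit alone decides the sign of every coordinate difference. The signs of the
  weights in the three coordinates are \<open>+++\<close> for the first digit, \<open>++-\<close> for the second, \<open>+-+\<close> for
  the third and \<open>+--\<close> for the last: one pattern for each type of chain.
\<close>
fun digit_point :: "int \<times> int \<times> int \<times> int \<Rightarrow> (int \<times> int) \<times> int" where
  "digit_point (a, b, c, d) = ((8*a + 4*b + 2*c + d, 8*a + 4*b - 2*c - d), 8*a - 4*b + 2*c - d)"

definition digits :: "(int \<times> int \<times> int \<times> int) set" where
  "digits = {0..1} \<times> {0..1} \<times> {0..1} \<times> {0..1}"

fun orientation :: "(int \<times> int) \<times> int \<Rightarrow> (int \<times> int) \<times> int \<Rightarrow> (int \<times> int) \<times> int" where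
  "orientation ((a, b), c) ((a', b'), c') = ((sgn (a' - a), sgn (b' - b)), sgn (c' - c))"

text \<open>
  If \<open>y\<close> lies between \<open>x\<close> and \<open>z\<close>, then no coordinate may turn back at \<open>y\<close>; without zeros the
  two orientations must therefore agree.
\<close>
lemma orientation_between:
  assumes "manhattan x y + manhattan y z = manhattan x z"
    and "orientation x y = ((p, q), r)" "orientation y z = ((p', q'), r')"
    and "0 \<notin> {p, q, r, p', q', r'}"
  shows "p = p' \<and> q = q' \<and> r = r'"
proof -
  obtain a b c a' b' c' where xy: "x = ((a, b), c)" "y = ((a', b'), c')"
    by (cases "(x, y)" rule: manhattan.cases) auto
  obtain a'' b'' c'' where z: "z = ((a'', b''), c'')"
    by (metis surj_pair)
  have triangle: "\<bar>i - k\<bar> \<le> \<bar>i - j\<bar> + \<bar>j - k\<bar>" for i j k :: int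
    by linarith
  have tight: "i' = i \<and> j' = j \<and> k' = k"
    if "i \<le> i'" "j \<le> j'" "k \<le> k'" "i' + j' + k' = i + j + k" for i j k i' j' k' :: int
    using that by linarith
  \<comment> \<open>Equality in the triangle inequality for the sum forces equality in each coordinate.\<close>
  have split: "\<bar>a - a'\<bar> + \<bar>a' - a''\<bar> = \<bar>a - a''\<bar>" "\<bar>b - b'\<bar> + \<bar>b' - b''\<bar> = \<bar>b - b''\<bar>"
    "\<bar>c - c'\<bar> + \<bar>c' - c''\<bar> = \<bar>c - c''\<bar>"
    using tight[OF triangle[of a a'' a'] triangle[of b b'' b'] triangle[of c c'' c']] assms(1)
    unfolding xy z manhattan.simps by (simp_all only: ac_simps)
  have same: "sgn (j - i) = sgn (k - j)"
    if "\<bar>i - j\<bar> + \<bar>j - k\<bar> = \<bar>i - k\<bar>" "sgn (j - i) \<noteq> 0" "sgn (k - j) \<noteq> 0" for i j k :: int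
    using that by (auto simp: sgn_if split: if_splits)
  show ?thesis
    using assms(2-4) same split unfolding xy z by auto
qed

text \<open>
  The change of the leading digit in which two digit vectors differ, spread over the three
  coordinates with the sign pattern of that digit.
\<close>
fun leading_difference :: "int \<times> int \<times> int \<times> int \<Rightarrow> int \<times> int \<times> int \<times> int \<Rightarrow> (int \<times> int) \<times> int" where
  "leading_difference (a, b, c, d) (a', b', c', d') =
    (if a \<noteq> a' then ((a' - a, a' - a), a' - a)
     else if b \<noteq> b' then ((b' - b, b' - b), b - b')
     else if c \<noteq> c' then ((c' - c, c - c'), c' - c)
     else ((d' - d, d - d'), d - d'))"

lemma orientation_digit_point:
  assumes "e \<in> digits" "f \<in> digits"
  shows "orientation (digit_point e) (digit_point f) = leading_difference e f"
proof -
  obtain a b c d a' b' c' d' where ef: "e = (a, b, c, d)" "f = (a', b', c', d')"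
    by (metis surj_pair)
  have bounds: "0 \<le> a" "a \<le> 1" "0 \<le> b" "b \<le> 1" "0 \<le> c" "c \<le> 1" "0 \<le> d" "d \<le> 1"
    "0 \<le> a'" "a' \<le> 1" "0 \<le> b'" "b' \<le> 1" "0 \<le> c'" "c' \<le> 1" "0 \<le> d'" "d' \<le> 1"
    using assms unfolding ef digits_def by simp_all
  have sgn_eqI: "sgn k = u" if "u = 1 \<and> 0 < k \<or> u = -1 \<and> k < 0" for k u :: int
    using that by auto
  have bit_neq: "i = 0 \<and> j = 1 \<or> i = 1 \<and> j = 0"
    if "0 \<le> i" "i \<le> 1" "0 \<le> j" "j \<le> 1" "i \<noteq> j" for i j :: int
    using that by linarith
  consider (a) "a \<noteq> a'" | (b) "a = a'" "b \<noteq> b'" | (c) "a = a'" "b = b'" "c \<noteq> c'"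
    | (d) "a = a'" "b = b'" "c = c'"
    by blast
  then show ?thesis
  proof cases
    case a
    then have lead: "leading_difference e f = ((a' - a, a' - a), a' - a)"
      by (simp add: ef)
    then show ?thesis
      unfolding lead unfolding ef digit_point.simps orientation.simps prod.inject
      using bit_neq[OF bounds(1,2,9,10) a] bounds(3-8,11-16)
      by (intro conjI sgn_eqI; elim disjE conjE; hypsubst; linarith)
  next
    case b
    then have lead: "leading_difference e f = ((b' - b, b' - b), b - b')"
      by (simp add: ef)
    then show ?thesis
      unfolding lead unfolding ef digit_point.simps orientation.simps prod.inject
      using bit_neq[OF bounds(3,4,11,12) b(2)] bounds(5-8,13-16) b(1)
      by (intro conjI sgn_eqI; elim disjE conjE; hypsubst; linarith)
  next
    case c
    then have lead: "leading_difference e f = ((c' - c, c - c'), c' - c)"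
      by (simp add: ef)
    then show ?thesis
      unfolding lead unfolding ef digit_point.simps orientation.simps prod.inject
      using bit_neq[OF bounds(5,6,13,14) c(3)] bounds(7,8,15,16) c(1,2)
      by (intro conjI sgn_eqI; elim disjE conjE; hypsubst; linarith)
  next
    case d
    have "d' - d = 0 \<or> d' - d = 1 \<or> d' - d = -1"
      using bounds(7,8,15,16) by linarith
    with d show ?thesis
      by (auto simp: ef)
  qed
qed

lemma leading_difference_nonzero:
  assumes "e \<noteq> f" "leading_difference e f = ((p, q), r)"
  shows "0 \<notin> {p, q, r}"
  using assms by (cases "(e, f)" rule: leading_difference.cases) (auto split: if_splits)

text \<open>
  Different digits have sign patterns that are neither equal nor opposite, so equal leading
  differences concern the same digit; and a binary digit cannot go up twice or down twice in a row.
\<close>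
lemma leading_difference_not_repeated:
  assumes "e \<in> digits" "f \<in> digits" "g \<in> digits" "e \<noteq> f"
  shows "leading_difference e f \<noteq> leading_difference f g"
proof -
  obtain a b c d a' b' c' d' where ef: "e = (a, b, c, d)" "f = (a', b', c', d')"
    by (metis surj_pair)
  obtain a'' b'' c'' d'' where g: "g = (a'', b'', c'', d'')"
    by (metis surj_pair)
  have turn: "i = j \<or> j - i \<noteq> k - j" if "i \<in> {0..1}" "j \<in> {0..1}" "k \<in> {0..1}"
    for i j k :: int
    using that unfolding atLeastAtMost_iff by linarith
  have "a = a' \<or> a' - a \<noteq> a'' - a'" "b = b' \<or> b' - b \<noteq> b'' - b'"
    "c = c' \<or> c' - c \<noteq> c'' - c'" "d = d' \<or> d' - d \<noteq> d'' - d'"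
    by (rule turn; use assms(1-3) in \<open>simp add: ef g digits_def\<close>)+
  then show ?thesis
    using assms(4) unfolding ef g leading_difference.simps prod.inject
    by (auto split: if_splits)
qed

lemma orientation_self: "orientation x x = ((0, 0), 0)"
  by (cases "(x, x)" rule: manhattan.cases) simp

lemma inj_on_digit_point: "inj_on digit_point digits"
proof (rule inj_onI, rule ccontr)
  fix e f assume "e \<in> digits" "f \<in> digits" "digit_point e = digit_point f" "e \<noteq> f"
  then show False
    using orientation_digit_point[of e f] orientation_self[of "digit_point f"]
      leading_difference_nonzero[of e f 0 0 0] by simp
qed

lemma card_digit_points: "card (digit_point ` digits) = 16"
proof -
  have "card (digit_point ` digits) = card digits"
    by (rule card_image[OF inj_on_digit_point])
  also have "\<dots> = 16"
    by (simp add: digits_def card_cartesian_product)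
  finally show ?thesis .
qed

lemma general_position_digit_points: "general_position_set grid (digit_point ` digits)"
proof -
  have False
    if efg: "e \<in> digits" "f \<in> digits" "g \<in> digits" "e \<noteq> f" "f \<noteq> g"
      and eq: "manhattan (digit_point e) (digit_point f) + manhattan (digit_point f) (digit_point g) =
        manhattan (digit_point e) (digit_point g)" for e f g
  proof -
    obtain p q r where ef: "leading_difference e f = ((p, q), r)"
      by (metis surj_pair)
    obtain p' q' r' where fg: "leading_difference f g = ((p', q'), r')"
      by (metis surj_pair)
    have "p = p' \<and> q = q' \<and> r = r'"
    proof (rule orientation_between[OF eq])
      show "orientation (digit_point e) (digit_point f) = ((p, q), r)"
        "orientation (digit_point f) (digit_point g) = ((p', q'), r')"
        using orientation_digit_point efg ef fg by simp_all
      show "0 \<notin> {p, q, r, p', q', r'}"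
        using leading_difference_nonzero[OF efg(4) ef] leading_difference_nonzero[OF efg(5) fg] by simp
    qed
    then show False
      using leading_difference_not_repeated[OF efg(1-4)] ef fg by simp
  qed
  then show ?thesis
    unfolding general_position_grid_iff by blast
qed

lemma gp_grid: "gp grid = enat 16"
  unfolding gp_eq_enat_iff
  using general_position_digit_points card_digit_points general_position_grid_card_le
  by blast

theorem proposition3p5:
  shows "10 \<le> gp (P_inf \<box> P_inf \<box> P_inf) \<and> gp (P_inf \<box> P_inf \<box> P_inf) \<le> 16"
  by (simp add: gp_grid numeral_eq_enat)

end
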